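(* Let $G=(V,E)$ be a finite simple undirected graph, and run on $G$ the recursive procedure $\mathrm{FC}_2$ described in the context. Then the procedure terminates, and upon termination the following hold. (i) For every vertex $v\in V$, every set in the list $a_v$ is a clique of $G$ containing $v$. Moreover, for any two distinct sets $S_i,S_j$ in $a_v$ we have $v\in S_i\cap S_j$, $S_i\not\subseteq S_j$ and $S_i\not\supseteq S_j$. (ii) A set of maximum cardinality among all sets in $\bigcup_{v\in V} a_v$ is a maximum clique of $G$.
   Context: For a graph $G$ and a vertex $v$, $N(v)$ is the set of neighbors of $v$ in $G$; a clique is a set of pairwise adjacent vertices, and a maximum clique is a clique of largest cardinality. Each vertex $v$ carries a list $a_v$ of vertex sets. Procedure $\mathrm{FC}_2(G)$, on a graph $G=(V,E)$: (1) Choose an arbitrary vertex $v\in V$, and let $M=N(v)$, computed in $G$. (2) Let $G'$ be the graph with vertex set $V\setminus\{v\}$ and edge set $E$ minus all edges incident to $v$. Set $a_v\leftarrow$ the empty list. (3) If $G'$ is nonempty, call $\mathrm{FC}_2(G')$, which computes the lists $a_x$ for $x\in V\setminus\{v\}$. Then, for each $x\in M$, do the following. If $a_x$ is empty, set $L=\{v,x\}$ and perform the update below once. Otherwise, for each set $A\in a_x$, set $L=(N(v)\cap A)\cup\{v,x\}$ and perform the update below. The update is as follows. Set $new\leftarrow$ FALSE and $old\leftarrow$ FALSE. For each set $B$ in $a_v$ (or once with $B=\emptyset$ if $a_v$ is empty): - if $|B|<|L|$, then first remove $B$ from $a_v$ if $B\neq\emptyset$ and $B\subset L$, and then set $new\leftarrow$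 TRUE; - otherwise, if $B\not\supseteq L$ set $new\leftarrow$ TRUE, else set $old\leftarrow$ TRUE. After this loop over $B$, if $new$ is TRUE and $old$ is FALSE, append $L$ to $a_v$. (4) Return $G$ together with the lists $a_v$. *)

theory Defs
  imports Main
begin

record 'a ugraph =
  verts :: "'a set"
  edges :: "'a set set"

definition simple_graph :: "'a ugraph \<Rightarrow> bool" where
  "simple_graph G \<longleftrightarrow> finite (verts G) \<and> (\<forall>e\<in>edges G. e \<subseteq> verts G \<and> card e = 2)"

definition nbrs :: "'a ugraph \<Rightarrow> 'a \<Rightarrow> 'a set" where
  "nbrs G v = {u. {v, u} \<in> edges G}"

definition del_vertex :: "'a ugraph \<Rightarrow> 'a \<Rightarrow> 'a ugraph" where
  "del_vertex G v = \<lparr>verts = verts G - {v}, edges = {e \<in> edges G. v \<notin> e}\<rparr>"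

definition clique :: "'a ugraph \<Rightarrow> 'a set \<Rightarrow> bool" where
  "clique G K \<longleftrightarrow> K \<subseteq> verts G \<and> (\<forall>x\<in>K. \<forall>y\<in>K. x \<noteq> y \<longrightarrow> {x, y} \<in> edges G)"

definition maximum_clique :: "'a ugraph \<Rightarrow> 'a set \<Rightarrow> bool" where
  "maximum_clique G K \<longleftrightarrow> is_arg_max card (clique G) K"

(* The state of the loop over B is the current list together with the flags new and old. *)
fun scan :: "'a set \<Rightarrow> 'a set \<Rightarrow> 'a set list \<times> bool \<times> bool \<Rightarrow> 'a set list \<times> bool \<times> bool" where
  "scan L B (av, new, old) =
    (if card B < card L then (if B \<noteq> {} \<and> B \<subset> L then remove1 B av else av, True, old)
     else if \<not> L \<subseteq> B then (av, True, old)
     else (av, new, True))"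

(* The loop ranges over the list as it was on entry; removals affect only the state. *)
definition update :: "'a set \<Rightarrow> 'a set list \<Rightarrow> 'a set list" where
  "update L av =
    (case fold (scan L) (if av = [] then [{}] else av) (av, False, False) of
       (av', new, old) \<Rightarrow> if new \<and> \<not> old then av' @ [L] else av')"

definition process_nbr ::
    "'a set \<Rightarrow> 'a \<Rightarrow> ('a \<Rightarrow> 'a set list) \<Rightarrow> 'a \<Rightarrow> 'a set list \<Rightarrow> 'a set list" where
  "process_nbr M v a x av =
    (if a x = [] then update {v, x} av
     else fold (\<lambda>A. update ((M \<inter> A) \<union> {v, x})) (a x) av)"

(* The arbitrary choices of the procedure are parameters: pick H is the vertex chosen when the
   procedure is called on H, and enum H M is the order in which that call runs through the
   neighbourhood M. A graph is encountered at most once in a run, so every run arises from some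
   pick and enum. Termination is not proved here: FC2_dom (pick, enum, G) expresses that the
   recursion from G terminates. On the graph without vertices, where no vertex can be chosen,
   the procedure stops with empty lists. *)
function (domintros) FC2 ::
    "('a ugraph \<Rightarrow> 'a) \<Rightarrow> ('a ugraph \<Rightarrow> 'a set \<Rightarrow> 'a list) \<Rightarrow> 'a ugraph \<Rightarrow> 'a \<Rightarrow> 'a set list" where
  "FC2 pick enum G =
    (if verts G = {} then (\<lambda>_. [])
     else
       let v = pick G; M = nbrs G v; G' = del_vertex G v in
       if verts G' = {} then (\<lambda>_. [])
       else
         let a = FC2 pick enum G' in
         a(v := fold (process_nbr M v a) (enum G M) []))"
  by pat_completeness auto

end

theory Submission
  imports Defs
begin

text \<open>
  Every clique with at least two vertices is contained in a set of \<open>a v\<close>, where \<open>v\<close> is the vertex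
  of the clique that is chosen first: by induction \<open>K - {v}\<close> lies in a set \<open>A\<close> of some \<open>a x\<close>, or
  equals \<open>{x}\<close>, so the candidate formed from \<open>v\<close>, \<open>x\<close> and \<open>A\<close> contains \<open>K\<close>. The update keeps the
  list an antichain and discards a set only in favour of a superset, so it never loses this property.
\<close>

section \<open>One list under a sequence of updates\<close>

lemma fold_scan:
  assumes "finite L" "\<forall>B\<in>set bs. finite B" "distinct av"
  shows "fold (scan L) bs (av, new, old) =
    (filter (\<lambda>B. \<not> (B \<in> set bs \<and> B \<noteq> {} \<and> B \<subset> L)) av,
     new \<or> (\<exists>B\<in>set bs. \<not> L \<subseteq> B), old \<or> (\<exists>B\<in>set bs. L \<subseteq> B))"
  using assms(2,3)
proof (induction bs arbitrary: av new old)
  case Nil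
  then show ?case by simp
next
  case (Cons B bs)
  \<comment> \<open>By finiteness the test on cardinalities never conflicts with inclusion, so the
    branch taken sets \<open>old\<close> exactly when \<open>L\<close> is contained in
    \<open>B\<close>, and sets \<open>new\<close> otherwise.\<close>
  have lt: "B \<subset> L \<Longrightarrow> card B < card L" and ge: "L \<subseteq> B \<Longrightarrow> \<not> card B < card L"
    using assms(1) Cons.prems(1) by (auto simp: psubset_card_mono card_mono leD)
  show ?case
  proof (cases "B \<noteq> {} \<and> B \<subset> L")
    case True
    \<comment> \<open>\<open>remove1\<close> drops one occurrence; in a distinct list that is every
      occurrence.\<close>
    have "remove1 B av = filter (\<lambda>C. C \<noteq> B) av"
      using Cons.prems(2) by (simp add: distinct_remove1_removeAll removeAll_filter_not_eq eq_commute)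
    with True lt Cons show ?thesis
      by (auto intro!: filter_cong)
  next
    case False
    then have "scan L B (av, new, old) = (av, new \<or> \<not> L \<subseteq> B, old \<or> L \<subseteq> B)"
      using ge by auto
    moreover have "filter (\<lambda>C. \<not> (C \<in> set (B # bs) \<and> C \<noteq> {} \<and> C \<subset> L)) av =
        filter (\<lambda>C. \<not> (C \<in> set bs \<and> C \<noteq> {} \<and> C \<subset> L)) av"
      using False by (auto intro!: filter_cong)
    ultimately show ?thesis
      using Cons by (simp del: scan.simps)
  qed
qed

lemma update_eq:
  assumes "finite L" "L \<noteq> {}" "\<forall>B\<in>set av. finite B \<and> B \<noteq> {}" "distinct av"
  shows "update L av =
    filter (\<lambda>B. \<not> B \<subset> L) av @ (if \<exists>B\<in>set av. L \<subseteq> B then [] else [L])"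
proof (cases "av = []")
  case True
  then show ?thesis
    using assms fold_scan[of L "[{}]" "[]" False False] by (simp add: update_def)
next
  case False
  have "filter (\<lambda>B. \<not> (B \<in> set av \<and> B \<noteq> {} \<and> B \<subset> L)) av = filter (\<lambda>B. \<not> B \<subset> L) av"
    using assms(3) by (auto intro!: filter_cong)
  \<comment> \<open>In a nonempty list \<open>new\<close> holds whenever \<open>old\<close> fails,
    so \<open>L\<close> is appended exactly when no member contains it. In the empty case the dummy
    set {} has the same effect, because \<open>L\<close> is nonempty.\<close>
  moreover have "(\<exists>B\<in>set av. \<not> L \<subseteq> B) \<or> (\<exists>B\<in>set av. L \<subseteq> B)"
    using False by (cases av) auto
  ultimately show ?thesis
    using assms False fold_scan[of L av av False False] by (auto simp: update_def)
qed

definition antichain :: "'a set set \<Rightarrow> bool" where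
  "antichain \<A> \<longleftrightarrow> (\<forall>S\<in>\<A>. \<forall>T\<in>\<A>. S \<subseteq> T \<longrightarrow> S = T)"

lemma fold_update:
  assumes "\<forall>L\<in>set Ls. finite L \<and> L \<noteq> {}" "\<forall>B\<in>set av. finite B \<and> B \<noteq> {}"
    and "distinct av" "antichain (set av)"
  shows "set (fold update Ls av) \<subseteq> set Ls \<union> set av \<and> antichain (set (fold update Ls av)) \<and>
    (\<forall>L\<in>set Ls \<union> set av. \<exists>B\<in>set (fold update Ls av). L \<subseteq> B)"
  using assms
proof (induction Ls arbitrary: av)
  case Nil
  then show ?case by auto
next
  case (Cons L Ls)
  let ?av = "update L av"
  have eq: "?av = filter (\<lambda>B. \<not> B \<subset> L) av @ (if \<exists>B\<in>set av. L \<subseteq> B then [] else [L])"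
    using Cons.prems by (intro update_eq) auto
  have sub: "set ?av \<subseteq> insert L (set av)"
    unfolding eq by auto
  \<comment> \<open>\<open>L\<close> is appended only when no member contains it, so it is new to
    the list and lies below no member; the filter has removed whatever lies properly below
    \<open>L\<close>.\<close>
  have "distinct ?av"
    using Cons.prems unfolding eq by auto
  moreover have "antichain (set ?av)"
    using Cons.prems(4) unfolding eq antichain_def by auto
  moreover have "\<forall>B\<in>set ?av. finite B \<and> B \<noteq> {}"
    using sub Cons.prems by auto
  ultimately have IH: "set (fold update Ls ?av) \<subseteq> set Ls \<union> set ?av"
      "antichain (set (fold update Ls ?av))"
      "\<forall>K\<in>set Ls \<union> set ?av. \<exists>B\<in>set (fold update Ls ?av). K \<subseteq> B"
    using Cons.IH[of ?av] Cons.prems(1) by auto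
  \<comment> \<open>Either \<open>L\<close> was appended, or some old member contains
    \<open>L\<close>; such a member is not a proper subset of \<open>L\<close> and survives the
    filter.\<close>
  have L: "\<exists>B\<in>set ?av. L \<subseteq> B"
    unfolding eq by auto
  moreover have "K \<in> set ?av" if "K \<in> set av" "\<not> K \<subset> L" for K
    using that unfolding eq by auto
  ultimately have "\<exists>B\<in>set ?av. K \<subseteq> B" if "K \<in> set av" for K
    using that by (cases "K \<subset> L") blast+
  with L have "\<forall>K\<in>set (L # Ls) \<union> set av. \<exists>B\<in>set Ls \<union> set ?av. K \<subseteq> B"
    by (simp only: set_simps Un_iff insert_iff) blast
  with IH have "\<forall>K\<in>set (L # Ls) \<union> set av. \<exists>B\<in>set (fold update Ls ?av). K \<subseteq> B"
    by (meson subset_trans)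
  moreover have "set (fold update Ls ?av) \<subseteq> set (L # Ls) \<union> set av"
    using IH(1) sub by auto
  ultimately show ?case
    using IH(2) by simp
qed

section \<open>Candidate sets and vertex deletion\<close>

definition candidates :: "'a set \<Rightarrow> 'a \<Rightarrow> ('a \<Rightarrow> 'a set list) \<Rightarrow> 'a \<Rightarrow> 'a set list" where
  "candidates M v a x = (if a x = [] then [{v, x}] else map (\<lambda>A. (M \<inter> A) \<union> {v, x}) (a x))"

text \<open>Updates at \<open>v\<close> leave \<open>a\<close> unchanged, so all candidates are
  known in advance and the nested loops flatten to one sequence of updates, to which
  \<open>fold_update\<close> applies.\<close>

lemma fold_process_nbr:
  "fold (process_nbr M v a) xs av = fold update (concat (map (candidates M v a) xs)) av"
  by (induction xs arbitrary: av) (auto simp: process_nbr_def candidates_def fold_map comp_def)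

lemma simple_graph_del_vertex: "simple_graph G \<Longrightarrow> simple_graph (del_vertex G v)"
  by (auto simp: simple_graph_def del_vertex_def)

lemma card_verts_del_vertex:
  "simple_graph G \<Longrightarrow> v \<in> verts G \<Longrightarrow> card (verts (del_vertex G v)) < card (verts G)"
  by (simp add: simple_graph_def del_vertex_def card_Diff1_less del: card_Diff_insert)

lemma nbrs_subset: "simple_graph G \<Longrightarrow> nbrs G v \<subseteq> verts (del_vertex G v)"
  by (fastforce simp: simple_graph_def nbrs_def del_vertex_def)

lemma clique_finite: "simple_graph G \<Longrightarrow> clique G K \<Longrightarrow> finite K"
  by (auto simp: simple_graph_def clique_def intro: finite_subset)

lemma clique_del_vertex_iff: "clique (del_vertex G v) K \<longleftrightarrow> clique G K \<and> v \<notin> K"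
  by (auto simp: clique_def del_vertex_def)

text \<open>Intersecting with the neighbourhood makes everything adjacent to \<open>v\<close>;
  adjacency to \<open>x\<close> comes from \<open>x\<close> being a member of the clique
  \<open>A\<close>.\<close>

lemma clique_candidate:
  assumes "clique (del_vertex G v) A" "x \<in> A" "x \<in> nbrs G v" "v \<in> verts G"
  shows "clique G ((nbrs G v \<inter> A) \<union> {v, x})"
  using assms by (auto simp: clique_def del_vertex_def nbrs_def insert_commute)

section \<open>Termination and the invariant of the recursion\<close>

lemma FC2_dom:
  assumes "simple_graph G" and pick: "\<And>H. verts H \<noteq> {} \<Longrightarrow> pick H \<in> verts H"
  shows "FC2_dom (pick, enum, G)"
  using assms(1)
proof (induction "card (verts G)" arbitrary: G rule: less_induct)
  case less
  show ?case
    \<comment> \<open>Since \<open>pick\<close> chooses inside the graph, the recursive call has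
      fewer vertices.\<close>
    by (rule FC2.domintros)
      (use less pick in \<open>auto intro!: less.hyps card_verts_del_vertex simple_graph_del_vertex\<close>)
qed

text \<open>The induction invariant. The covering set must occur in the list of a vertex of
  \<open>K\<close> itself: when a clique is extended by a newly chosen vertex, that vertex of
  \<open>K\<close> is then a neighbour whose list is read. Singletons are left out because an
  isolated vertex gets an empty list.\<close>

definition clique_lists :: "'a ugraph \<Rightarrow> ('a \<Rightarrow> 'a set list) \<Rightarrow> bool" where
  "clique_lists G a \<longleftrightarrow>
    (\<forall>v\<in>verts G. (\<forall>S\<in>set (a v). clique G S \<and> v \<in> S) \<and> antichain (set (a v))) \<and>
    (\<forall>K. clique G K \<longrightarrow> 2 \<le> card K \<longrightarrow> (\<exists>v\<in>K. \<exists>A\<in>set (a v). K \<subseteq> A))"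

lemma clique_lists_step:
  fixes G :: "'a ugraph"
  assumes G: "simple_graph G" and v: "v \<in> verts G"
    and a: "clique_lists (del_vertex G v) a" and xs: "set xs = nbrs G v"
  shows "clique_lists G (a(v := fold (process_nbr (nbrs G v) v a) xs []))"
proof -
  let ?G' = "del_vertex G v" and ?M = "nbrs G v"
  let ?Ls = "concat (map (candidates ?M v a) xs)"
  let ?av = "fold (process_nbr ?M v a) xs []"
  have cand: "clique G L \<and> v \<in> L" if L: "L \<in> set (candidates ?M v a x)" and x: "x \<in> ?M" for L x
  proof (cases "a x = []")
    case True
    with L x v nbrs_subset[OF G] show ?thesis
      by (auto simp: candidates_def clique_def del_vertex_def nbrs_def insert_commute)
  next
    case False
    with L obtain A where A: "A \<in> set (a x)" "L = (?M \<inter> A) \<union> {v, x}"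
      by (auto simp: candidates_def)
    from x have "x \<in> verts ?G'"
      using nbrs_subset[OF G] by auto
    with a A(1) have "clique ?G' A" "x \<in> A"
      by (auto simp: clique_lists_def)
    with A(2) x v show ?thesis
      using clique_candidate[of G v A x] by auto
  qed
  then have Ls: "\<forall>L\<in>set ?Ls. clique G L \<and> v \<in> L"
    using xs by auto
  have "\<forall>L\<in>set ?Ls. finite L \<and> L \<noteq> {}"
    using Ls clique_finite[OF G] by blast
  then have av: "set ?av \<subseteq> set ?Ls" "antichain (set ?av)" "\<forall>L\<in>set ?Ls. \<exists>B\<in>set ?av. L \<subseteq> B"
    unfolding fold_process_nbr using fold_update[of ?Ls "[]"] by (auto simp: antichain_def)
  have "\<exists>w\<in>K. \<exists>A\<in>set ((a(v := ?av)) w). K \<subseteq> A" if K: "clique G K" "2 \<le> card K" for K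
  proof (cases "v \<in> K")
    case False
    with K a obtain w A where "w \<in> K" "A \<in> set (a w)" "K \<subseteq> A"
      by (meson clique_del_vertex_iff clique_lists_def)
    \<comment> \<open>\<open>w\<close> lies in \<open>K\<close> and \<open>v\<close> does not, so
      the list of \<open>w\<close> is not the one overwritten.\<close>
    with False show ?thesis by (intro bexI[of _ w] bexI[of _ A]) auto
  next
    case True
    let ?K = "K - {v}"
    have fin: "finite K"
      using clique_finite[OF G K(1)] .
    have K': "clique ?G' ?K"
      unfolding clique_del_vertex_iff using K(1) by (auto simp: clique_def)
    have KM: "?K \<subseteq> ?M"
      using K(1) True by (auto simp: clique_def nbrs_def)
    have "\<exists>x\<in>?K. \<exists>L\<in>set (candidates ?M v a x). K \<subseteq> L"
    proof (cases "2 \<le> card ?K")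
      case True
      \<comment> \<open>The vertex \<open>x\<close> given by the invariant lies in
        \<open>?K\<close>, hence among the neighbours of \<open>v\<close>, so its list contributes
        candidates.\<close>
      then obtain x A where A: "x \<in> ?K" "A \<in> set (a x)" "?K \<subseteq> A"
        using a K' unfolding clique_lists_def by blast
      then have "?M \<inter> A \<union> {v, x} \<in> set (candidates ?M v a x)" "K \<subseteq> ?M \<inter> A \<union> {v, x}"
        using KM by (auto simp: candidates_def)
      with A(1) show ?thesis by blast
    next
      case False
      then have "card ?K = 1"
        using True K(2) fin by simp
      then obtain x where x: "?K = {x}"
        by (auto simp: card_1_singleton_iff)
      \<comment> \<open>Here \<open>K\<close> is a single edge and the invariant does not cover
        \<open>?K\<close>. Still, there is a candidate whether or not \<open>a x\<close> is empty,
        and every candidate contains both ends.\<close>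
      have "\<exists>L\<in>set (candidates ?M v a x). {v, x} \<subseteq> L"
        by (cases "a x") (auto simp: candidates_def)
      moreover have "K \<subseteq> {v, x}"
        using x by auto
      ultimately have "\<exists>L\<in>set (candidates ?M v a x). K \<subseteq> L"
        by (meson subset_trans)
      with x show ?thesis by auto
    qed
    then obtain L where "L \<in> set ?Ls" "K \<subseteq> L"
      using KM xs by auto
    with av(3) obtain B where "B \<in> set ?av" "K \<subseteq> B"
      by (meson subset_trans)
    with True show ?thesis by (intro bexI[of _ v]) auto
  qed
  moreover have "(\<forall>S\<in>set ((a(v := ?av)) w). clique G S \<and> w \<in> S) \<and> antichain (set ((a(v := ?av)) w))"
    if "w \<in> verts G" for w
  proof (cases "w = v")
    case True
    with av(1,2) Ls show ?thesis by auto
  next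
    case False
    with that have "w \<in> verts ?G'"
      by (simp add: del_vertex_def)
    with False a show ?thesis
      by (simp add: clique_lists_def clique_del_vertex_iff)
  qed
  ultimately show ?thesis
    unfolding clique_lists_def by blast
qed

text \<open>Serves both early exits of \<open>FC2\<close>, on no vertex and on one vertex: no clique
  there is large enough to need covering.\<close>

lemma clique_lists_trivial:
  assumes "verts G \<subseteq> {v}"
  shows "clique_lists G (\<lambda>_. [])"
proof -
  have "card K \<le> 1" if "clique G K" for K
    using that assms card_mono[of "{v}" K] by (auto simp: clique_def)
  then show ?thesis
    by (fastforce simp: clique_lists_def antichain_def)
qed

lemma clique_lists_FC2:
  assumes "simple_graph G" and pick: "\<And>H. verts H \<noteq> {} \<Longrightarrow> pick H \<in> verts H"
    and enum: "\<And>H M. finite M \<Longrightarrow> set (enum H M) = M \<and> distinct (enum H M)"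
  shows "clique_lists G (FC2 pick enum G)"
  using assms(1)
proof (induction "card (verts G)" arbitrary: G rule: less_induct)
  case less
  let ?v = "pick G"
  let ?G' = "del_vertex G ?v"
  note FC2_eq = FC2.psimps[OF FC2_dom[OF less.prems pick, where enum = enum]]
  show ?case
  proof (cases "verts G = {} \<or> verts ?G' = {}")
    case True
    then have "verts G \<subseteq> {?v}"
      by (auto simp: del_vertex_def)
    then have "clique_lists G (\<lambda>_. [])"
      by (rule clique_lists_trivial)
    moreover have "FC2 pick enum G = (\<lambda>_. [])"
      using True by (auto simp: FC2_eq Let_def)
    ultimately show ?thesis by simp
  next
    case False
    have v: "?v \<in> verts G"
      using False pick by auto
    have "finite (nbrs G ?v)"
      using nbrs_subset[OF less.prems] simple_graph_del_vertex[OF less.prems]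
      by (meson finite_subset simple_graph_def)
    then have "set (enum G (nbrs G ?v)) = nbrs G ?v"
      using enum by blast
    moreover have "clique_lists ?G' (FC2 pick enum ?G')"
      using less v by (intro less.hyps card_verts_del_vertex simple_graph_del_vertex)
    ultimately show ?thesis
      using False clique_lists_step[OF less.prems v] by (simp add: FC2_eq Let_def)
  qed
qed

section \<open>From covered cliques to maximum cliques\<close>

theorem theorem2:
  fixes G :: "'a ugraph"
    and pick :: "'a ugraph \<Rightarrow> 'a"
    and enum :: "'a ugraph \<Rightarrow> 'a set \<Rightarrow> 'a list"
  assumes "simple_graph G"
    and "\<And>H. verts H \<noteq> {} \<Longrightarrow> pick H \<in> verts H"
    and "\<And>H M. finite M \<Longrightarrow> set (enum H M) = M \<and> distinct (enum H M)"
  shows "FC2_dom (pick, enum, G) \<and>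
    (let a = FC2 pick enum G in
      (\<forall>v\<in>verts G.
        (\<forall>S\<in>set (a v). clique G S \<and> v \<in> S) \<and>
        (\<forall>S\<in>set (a v). \<forall>T\<in>set (a v). S \<noteq> T \<longrightarrow>
          v \<in> S \<inter> T \<and> \<not> S \<subseteq> T \<and> \<not> T \<subseteq> S)) \<and>
      (edges G \<noteq> {} \<longrightarrow> (\<Union>v\<in>verts G. set (a v)) \<noteq> {}) \<and>
      (\<forall>S. is_arg_max card (\<lambda>S. S \<in> (\<Union>v\<in>verts G. set (a v))) S \<longrightarrow> maximum_clique G S))"
proof -
  let ?a = "FC2 pick enum G"
  let ?U = "\<Union>v\<in>verts G. set (?a v)"
  have cov: "clique_lists G ?a"
    using assms by (rule clique_lists_FC2)
  have sound: "clique G S \<and> v \<in> S" if "v \<in> verts G" "S \<in> set (?a v)" for v S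
    using cov that by (auto simp: clique_lists_def)
  have anti: "\<not> S \<subseteq> T" if "v \<in> verts G" "S \<in> set (?a v)" "T \<in> set (?a v)" "S \<noteq> T" for v S T
    using cov that by (auto simp: clique_lists_def antichain_def)
  have cover: "\<exists>A\<in>?U. K \<subseteq> A" if "clique G K" "2 \<le> card K" for K
  proof -
    from cov that obtain v A where "v \<in> K" "A \<in> set (?a v)" "K \<subseteq> A"
      unfolding clique_lists_def by blast
    moreover from this(1) that(1) have "v \<in> verts G"
      by (auto simp: clique_def)
    ultimately show ?thesis by blast
  qed
  \<comment> \<open>An edge is a clique of size two and must be covered, so with an edge present
    there are sets to maximise over.\<close>
  have nonempty: "?U \<noteq> {}" if "edges G \<noteq> {}"
  proof -
    from that obtain e where "e \<in> edges G" by auto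
    then have "clique G e" "card e = 2"
      using assms(1) by (auto simp: simple_graph_def clique_def card_2_iff insert_commute)
    then have "\<exists>A\<in>?U. e \<subseteq> A"
      by (intro cover) simp_all
    then show ?thesis
      by (metis bex_empty)
  qed
  have maximum: "maximum_clique G S" if S: "is_arg_max card (\<lambda>S. S \<in> ?U) S" for S
  proof -
    from S have "S \<in> ?U" and le: "\<And>A. A \<in> ?U \<Longrightarrow> card A \<le> card S"
      by (auto simp: is_arg_max_linorder)
    then have cS: "clique G S" and "S \<noteq> {}"
      using sound by auto
    \<comment> \<open>Cliques with at most one vertex may be uncovered; they are bounded because
      \<open>S\<close> contains the vertex in whose list it occurs.\<close>
    then have S1: "1 \<le> card S"
      using clique_finite[OF assms(1)] by (simp add: Suc_le_eq card_gt_0_iff)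
    have "card K \<le> card S" if K: "clique G K" for K
    proof (cases "2 \<le> card K")
      case True
      then obtain A where A: "A \<in> ?U" "K \<subseteq> A"
        using cover K by blast
      then have "finite A"
        using sound clique_finite[OF assms(1)] by blast
      then have "card K \<le> card A"
        using A(2) by (rule card_mono)
      also have "\<dots> \<le> card S"
        using A(1) by (rule le)
      finally show ?thesis .
    next
      case False
      with S1 show ?thesis by simp
    qed
    with cS show ?thesis
      by (simp add: maximum_clique_def is_arg_max_linorder)
  qed
  have lists: "\<forall>v\<in>verts G. (\<forall>S\<in>set (?a v). clique G S \<and> v \<in> S) \<and>
      (\<forall>S\<in>set (?a v). \<forall>T\<in>set (?a v). S \<noteq> T \<longrightarrow> v \<in> S \<inter> T \<and> \<not> S \<subseteq> T \<and> \<not> T \<subseteq> S)"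
    using sound anti by (metis IntI)
  show ?thesis
    unfolding Let_def
  proof (intro conjI)
    show "FC2_dom (pick, enum, G)"
      using assms(1,2) by (rule FC2_dom)
  qed (use lists nonempty maximum in \<open>iprover+\<close>)
qed

end
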